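(* Let $\rho^0\in\mathcal{P}_o(G)$ and let $\rho:[0,\infty)\to\mathcal{P}_o(G)$ be the solution with $\rho(0)=\rho^0$ of $$\frac{d\rho_i}{dt}=\sum_{j\in N(i)}\omega_{ij}\theta_{ij}(\rho)\big(\mathbb{V}_j-\mathbb{V}_i+(\mathbb{W}\rho)_j-(\mathbb{W}\rho)_i\big)+\beta\sum_{j\in N(i)}\omega_{ij}\theta_{ij}(\rho)(\log\rho_j-\log\rho_i),\qquad i\in V.$$ Assume that $\lim_{t\to\infty}\rho(t)=\rho^\infty$, where $\rho^\infty\in\mathcal{P}_o(G)$ is an isolated equilibrium of this equation, and that $$\lambda=\lambda_{sec}\big(L(\rho^\infty)\cdot\mathrm{Hess}\mathcal{F}(\rho^\infty)\big)>0.$$ Then for any sufficiently small $\epsilon>0$ satisfying $\lambda-\epsilon>0$ there exists a time $T>0$ such that for all $t>T$ $$\mathcal{F}(\rho(t))-\mathcal{F}(\rho^\infty)\le e^{-2(\lambda-\epsilon)(t-T)}\big(\mathcal{F}(\rho^0)-\mathcal{F}(\rho^\infty)\big).$$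
   Context: $G=(V,E,\omega)$ is a finite connected undirected weighted graph without self loops or multiple edges, $V=\{1,\dots,n\}$, $n\ge2$, with symmetric weights $\omega_{ij}=\omega_{ji}>0$ if $(i,j)\in E$ and $\omega_{ij}=0$ otherwise; $E$ is regarded as a symmetric set of ordered pairs. $N(i)=\{j\in V:(i,j)\in E\}$. $\mathcal{P}(G)=\{\rho\in\mathbb{R}^n:\sum_i\rho_i=1,\ \rho_i\ge0\}$ and $\mathcal{P}_o(G)$ is its interior (all $\rho_i>0$). $\theta_{ij}(\rho)=\frac{\rho_i+\rho_j}{2}$ for $(i,j)\in E$. $\mathcal{F}(\rho)=\frac12\rho^T\mathbb{W}\rho+\mathbb{V}^T\rho+\beta\sum_{i=1}^n\rho_i\log\rho_i$, with $\beta>0$, $\mathbb{V}\in\mathbb{R}^n$, $\mathbb{W}\in\mathbb{R}^{n\times n}$ symmetric (not necessarily positive definite), and $\mathrm{Hess}\mathcal{F}(\rho)=(\partial^2\mathcal{F}/\partial\rho_i\partial\rho_j)_{i,j}=\mathbb{W}+\beta\,\mathrm{diag}(1/\rho_i)$. $L(\rho)\in\mathbb{R}^{n\times n}$ is the $\rho$-weighted graph Laplacian, $(L(\rho)\Phi)_i=\sum_{j\in N(i)}\omega_{ij}\theta_{ij}(\rho)(\Phi_i-\Phi_j)$, which is symmetric positive semidefinite. $\lambda_{sec}(A)$ is the second smallest eigenvalue, counted with multiplicity, of a matrix $A$ with real eigenvalues (the product of the symmetric positive semidefinite matrix $L(\rho^\infty)$ with a symmetric matrix has real eigenvalues, and $0$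 is one of them). *)

theory Defs
  imports "HOL-Analysis.Analysis" "HOL-Computational_Algebra.Polynomial"
begin

definition charpoly :: "real^'n^'n \<Rightarrow> real poly" where
  "charpoly A = det (\<chi> i j. (if i = j then [:0, 1:] else 0) - [:A $ i $ j:])"

definition eigenvalues :: "real^'n^'n \<Rightarrow> real multiset" where
  "eigenvalues A = proots (charpoly A)"

text \<open>Only meaningful if the matrix has at least two real eigenvalues, counted with
  (algebraic) multiplicity; in particular for matrices of size at least two all of whose
  eigenvalues are real.\<close>

definition lambda_sec :: "real^'n^'n \<Rightarrow> real" where
  "lambda_sec A = sorted_list_of_multiset (eigenvalues A) ! 1"

lemma poly_charpoly: "poly (charpoly A) x = det (mat x - A)"
  unfolding charpoly_def det_def
  by (auto simp: poly_sum poly_prod mat_def intro!: sum.cong prod.cong)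

lemma poly_charpoly_eq_0_iff:
  "poly (charpoly A) x = 0 \<longleftrightarrow> (\<exists>v. v \<noteq> 0 \<and> A *v v = x *\<^sub>R v)"
proof -
  have mat: "mat x *v v = x *\<^sub>R v" for v :: "real^'a"
    by (simp add: matrix_vector_mult_def mat_def vec_eq_iff if_distrib[where f="\<lambda>a. a * _"]
        cong: if_cong)
  have "poly (charpoly A) x = 0 \<longleftrightarrow> (\<exists>v. v \<noteq> 0 \<and> (mat x - A) *v v = 0)"
    unfolding poly_charpoly using invertible_det_nz matrix_left_invertible_ker
      invertible_left_inverse by metis
  then show ?thesis
    by (auto simp: matrix_vector_mult_diff_rdistrib mat)
qed

lemma charpoly_nonzero: "charpoly A \<noteq> 0"
proof
  assume "charpoly A = 0"
  then obtain v where v: "v \<noteq> 0" "A *v v = (onorm ((*v) A) + 1) *\<^sub>R v"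
    using poly_charpoly_eq_0_iff[of A "onorm ((*v) A) + 1"] by auto
  have bl: "bounded_linear ((*v) A)"
    by (rule matrix_vector_mul_bounded_linear)
  have "\<bar>onorm ((*v) A) + 1\<bar> * norm v \<le> onorm ((*v) A) * norm v"
    using onorm[OF bl, of v] v(2) by simp
  then show False
    using v(1) onorm_pos_le[OF bl] by (simp add: algebra_simps)
qed

lemma mem_eigenvalues_iff:
  "x \<in># eigenvalues A \<longleftrightarrow> (\<exists>v. v \<noteq> 0 \<and> A *v v = x *\<^sub>R v)"
  by (simp add: eigenvalues_def charpoly_nonzero poly_charpoly_eq_0_iff)

lemma count_eigenvalues: "count (eigenvalues A) x = order x (charpoly A)"
  by (simp add: eigenvalues_def charpoly_nonzero)

definition partial_deriv :: "'n::finite \<Rightarrow> (real^'n \<Rightarrow> real) \<Rightarrow> real^'n \<Rightarrow> real" where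
  "partial_deriv i f x = deriv (\<lambda>s. f (x + s *\<^sub>R axis i 1)) 0"

definition Hess :: "(real^'n \<Rightarrow> real) \<Rightarrow> real^'n \<Rightarrow> real^'n^'n" where
  "Hess f x = (\<chi> i j. partial_deriv i (partial_deriv j f) x)"

definition weighted_graph :: "('n::finite \<times> 'n) set \<Rightarrow> ('n \<Rightarrow> 'n \<Rightarrow> real) \<Rightarrow> bool" where
  "weighted_graph E \<omega> \<longleftrightarrow>
     sym E \<and> irrefl E \<and> (\<forall>i j. (i, j) \<in> E\<^sup>*) \<and>
     (\<forall>i j. \<omega> i j = \<omega> j i) \<and>
     (\<forall>i j. (i, j) \<in> E \<longrightarrow> \<omega> i j > 0) \<and>
     (\<forall>i j. (i, j) \<notin> E \<longrightarrow> \<omega> i j = 0)"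

definition nbrs :: "('n \<times> 'n) set \<Rightarrow> 'n \<Rightarrow> 'n set" where
  "nbrs E i = {j. (i, j) \<in> E}"

definition prob_interior :: "(real^'n) set" where
  "prob_interior = {\<rho>. (\<Sum>i\<in>UNIV. \<rho> $ i) = 1 \<and> (\<forall>i. \<rho> $ i > 0)}"

definition theta :: "real^'n \<Rightarrow> 'n \<Rightarrow> 'n \<Rightarrow> real" where
  "theta \<rho> i j = (\<rho> $ i + \<rho> $ j) / 2"

definition weighted_laplacian ::
    "('n::finite \<times> 'n) set \<Rightarrow> ('n \<Rightarrow> 'n \<Rightarrow> real) \<Rightarrow> real^'n \<Rightarrow> real^'n^'n" where
  "weighted_laplacian E \<omega> \<rho> =
     matrix (\<lambda>\<Phi>. \<chi> i. \<Sum>j\<in>nbrs E i. \<omega> i j * theta \<rho> i j * (\<Phi> $ i - \<Phi> $ j))"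

lemma weighted_laplacian_mult:
  "(weighted_laplacian E \<omega> \<rho> *v \<Phi>) $ i =
     (\<Sum>j\<in>nbrs E i. \<omega> i j * theta \<rho> i j * (\<Phi> $ i - \<Phi> $ j))"
proof -
  have "linear (\<lambda>\<Phi>::real^'a. (\<chi> i. \<Sum>j\<in>nbrs E i. \<omega> i j * theta \<rho> i j * (\<Phi> $ i - \<Phi> $ j)))"
    by (rule linearI)
      (auto simp: vec_eq_iff algebra_simps sum.distrib sum_subtractf sum_distrib_left)
  then show ?thesis
    by (simp add: weighted_laplacian_def matrix_works)
qed

definition free_energy :: "real^'n^'n \<Rightarrow> real^'n \<Rightarrow> real \<Rightarrow> real^'n \<Rightarrow> real" where
  "free_energy W V \<beta> \<rho> =
     1 / 2 * (\<rho> \<bullet> (W *v \<rho>)) + V \<bullet> \<rho> + \<beta> * (\<Sum>i\<in>UNIV. \<rho> $ i * ln (\<rho> $ i))"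

definition fp_rhs ::
    "('n::finite \<times> 'n) set \<Rightarrow> ('n \<Rightarrow> 'n \<Rightarrow> real) \<Rightarrow> real^'n^'n \<Rightarrow> real^'n \<Rightarrow> real \<Rightarrow> real^'n \<Rightarrow> real^'n"
  where
  "fp_rhs E \<omega> W V \<beta> \<rho> =
     (\<chi> i. (\<Sum>j\<in>nbrs E i. \<omega> i j * theta \<rho> i j * (V $ j - V $ i + (W *v \<rho>) $ j - (W *v \<rho>) $ i))
         + \<beta> * (\<Sum>j\<in>nbrs E i. \<omega> i j * theta \<rho> i j * (ln (\<rho> $ j) - ln (\<rho> $ i))))"

definition fp_equilibria ::
    "('n::finite \<times> 'n) set \<Rightarrow> ('n \<Rightarrow> 'n \<Rightarrow> real) \<Rightarrow> real^'n^'n \<Rightarrow> real^'n \<Rightarrow> real \<Rightarrow> (real^'n) set" where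
  "fp_equilibria E \<omega> W V \<beta> = {\<rho> \<in> prob_interior. fp_rhs E \<omega> W V \<beta> \<rho> = 0}"

definition fp_solution ::
    "('n::finite \<times> 'n) set \<Rightarrow> ('n \<Rightarrow> 'n \<Rightarrow> real) \<Rightarrow> real^'n^'n \<Rightarrow> real^'n \<Rightarrow> real
      \<Rightarrow> real^'n \<Rightarrow> (real \<Rightarrow> real^'n) \<Rightarrow> bool" where
  "fp_solution E \<omega> W V \<beta> \<rho>0 \<rho> \<longleftrightarrow>
     \<rho> 0 = \<rho>0 \<and>
     (\<forall>t\<ge>0. \<rho> t \<in> prob_interior \<and>
        (\<rho> has_vector_derivative fp_rhs E \<omega> W V \<beta> (\<rho> t)) (at t within {0..}))"

lemma partial_free_energy:
  assumes sym: "transpose W = W" and pos: "\<rho> $ j > 0"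
  shows "partial_deriv j (free_energy W V \<beta>) \<rho> = (W *v \<rho>) $ j + V $ j + \<beta> * (ln (\<rho> $ j) + 1)"
proof -
  define e :: "real^'a" where "e = axis j 1"
  have e[simp]: "e $ k = (if k = j then 1 else 0)" for k
    by (simp add: e_def axis_def)
  have inner_e: "e \<bullet> x = x $ j" for x
    unfolding e_def by (metis cart_eq_inner_axis inner_commute)
  have sW: "\<rho> \<bullet> (W *v e) = (W *v \<rho>) $ j"
    by (metis sym inner_e dot_lmul_matrix inner_commute transpose_matrix_vector)
  have line: "free_energy W V \<beta> (\<rho> + s *\<^sub>R e) =
      1 / 2 * (\<rho> \<bullet> (W *v \<rho>) + 2 * s * (W *v \<rho>) $ j + s\<^sup>2 * (e \<bullet> (W *v e))) + V \<bullet> \<rho> + s * V $ j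
      + \<beta> * ((\<rho> $ j + s) * ln (\<rho> $ j + s) + (\<Sum>i\<in>UNIV - {j}. \<rho> $ i * ln (\<rho> $ i)))" for s
  proof -
    have "(\<Sum>i\<in>UNIV. (\<rho> + s *\<^sub>R e) $ i * ln ((\<rho> + s *\<^sub>R e) $ i)) =
        (\<rho> $ j + s) * ln (\<rho> $ j + s) + (\<Sum>i\<in>UNIV - {j}. \<rho> $ i * ln (\<rho> $ i))"
      by (subst sum.remove[of _ j]) (auto intro!: sum.cong)
    moreover have "(\<rho> + s *\<^sub>R e) \<bullet> (W *v (\<rho> + s *\<^sub>R e)) =
        \<rho> \<bullet> (W *v \<rho>) + 2 * s * (W *v \<rho>) $ j + s\<^sup>2 * (e \<bullet> (W *v e))"
      by (simp add: matrix_vector_right_distrib matrix_vector_mult_scaleR inner_add_left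
          inner_add_right sW inner_e power2_eq_square algebra_simps)
    moreover have "V \<bullet> (\<rho> + s *\<^sub>R e) = V \<bullet> \<rho> + s * V $ j"
      by (simp add: inner_add_right inner_commute[of V e] inner_e)
    ultimately show ?thesis
      unfolding free_energy_def by simp
  qed
  have "((\<lambda>s. free_energy W V \<beta> (\<rho> + s *\<^sub>R e)) has_real_derivative
      (W *v \<rho>) $ j + V $ j + \<beta> * (ln (\<rho> $ j) + 1)) (at 0)"
    unfolding line using pos by (auto intro!: derivative_eq_intros simp: algebra_simps)
  then show ?thesis
    unfolding partial_deriv_def e_def by (rule DERIV_imp_deriv)
qed

lemma Hess_free_energy:
  assumes sym: "transpose W = W" and pos: "\<And>i. \<rho> $ i > 0"
  shows "Hess (free_energy W V \<beta>) \<rho> = W + \<beta> *\<^sub>R (\<chi> i j. if i = j then 1 / \<rho> $ i else 0)"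
proof -
  have "partial_deriv i (partial_deriv j (free_energy W V \<beta>)) \<rho> =
      W $ i $ j + (if i = j then \<beta> / \<rho> $ i else 0)" for i j
  proof -
    define e :: "real^'a" where "e = axis i 1"
    have e[simp]: "e $ k = (if k = i then 1 else 0)" for k
      by (simp add: e_def axis_def)
    have We: "(W *v e) $ j = W $ i $ j"
    proof -
      have "(W *v e) $ j = W $ j $ i"
        by (simp add: matrix_vector_mult_def if_distrib cong: if_cong)
      also have "\<dots> = transpose W $ i $ j"
        by (simp add: transpose_def)
      finally show ?thesis using sym by simp
    qed
    define g where "g s = (W *v \<rho>) $ j + s * W $ i $ j + V $ j
        + \<beta> * (ln (\<rho> $ j + s * e $ j) + 1)" for s
    have "eventually (\<lambda>s::real. \<rho> $ j + s * e $ j > 0) (nhds 0)"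
    proof -
      have "((\<lambda>s::real. \<rho> $ j + s * e $ j) \<longlongrightarrow> \<rho> $ j + 0 * e $ j) (nhds 0)"
        by (intro tendsto_intros filterlim_ident)
      then have "((\<lambda>s::real. \<rho> $ j + s * e $ j) \<longlongrightarrow> \<rho> $ j) (nhds 0)"
        by simp
      then show ?thesis
        by (rule order_tendstoD(1)) (rule pos)
    qed
    then have ev: "eventually (\<lambda>s. partial_deriv j (free_energy W V \<beta>) (\<rho> + s *\<^sub>R e) = g s) (nhds 0)"
      by eventually_elim
        (use We in \<open>simp add: partial_free_energy[OF sym] g_def matrix_vector_right_distrib
          matrix_vector_mult_scaleR del: e\<close>)
    have "(g has_real_derivative W $ i $ j + \<beta> * (e $ j / \<rho> $ j)) (at 0)"
      unfolding g_def using pos[of j]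
      by (auto intro!: derivative_eq_intros simp del: e)
    then have "deriv g 0 = W $ i $ j + \<beta> * (e $ j / \<rho> $ j)"
      by (rule DERIV_imp_deriv)
    then have "deriv (\<lambda>s. partial_deriv j (free_energy W V \<beta>) (\<rho> + s *\<^sub>R e)) 0
        = W $ i $ j + \<beta> * (e $ j / \<rho> $ j)"
      using deriv_cong_ev[OF ev refl] by simp
    then show ?thesis
      unfolding partial_deriv_def[of i] e_def[symmetric] by auto
  qed
  then show ?thesis
    by (simp add: Hess_def vec_eq_iff)
qed

end

theory Submission
  imports Defs
begin

text \<open>The equation is the gradient flow \<open>\<rho>' = - L(\<rho>) \<nabla>F(\<rho>)\<close>, so \<open>F\<close> decreases at the rate
  \<open>\<nabla>F(\<rho>) \<bullet> L(\<rho>) \<nabla>F(\<rho>)\<close>. Let \<open>a\<close> be the limit, \<open>L = L(a)\<close>, \<open>H = Hess F(a)\<close>. Since \<open>0\<close> is an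
  eigenvalue of \<open>L H\<close> and the second smallest one, \<open>\<lambda>\<close>, is positive, a minimiser of the
  Rayleigh quotient of \<open>L H L\<close> relative to \<open>L\<close> on the vectors of sum zero yields an eigenvalue
  of \<open>L H\<close> that is at least \<open>\<lambda>\<close>. Hence every \<open>h = L u\<close> satisfies \<open>h \<bullet> H h \<ge> \<lambda> (u \<bullet> L u)\<close>, and the
  Cauchy-Schwarz inequality for \<open>L\<close> gives \<open>\<lambda> (g \<bullet> h)\<^sup>2 \<le> (g \<bullet> L g) (h \<bullet> H h)\<close> for all \<open>g\<close>.
  Near \<open>a\<close>, with \<open>h = \<rho> - a\<close> and \<open>g = \<nabla>F(\<rho>) - \<nabla>F(a)\<close>, both \<open>g \<bullet> h\<close> and \<open>2 (F(\<rho>) - F(a))\<close> are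
  \<open>h \<bullet> H h\<close> up to a factor close to \<open>1\<close>, so the dissipation is at least
  \<open>2 (\<lambda> - \<epsilon>) (F(\<rho>) - F(a))\<close>, and Gronwall's inequality concludes.\<close>

subsection \<open>The second smallest eigenvalue\<close>

text \<open>If the second entry exceeded both \<open>x\<close> and \<open>y\<close>, only the first
  position could hold either of them. The sub-multiset form makes \<open>x = y\<close> demand
  multiplicity two.\<close>

lemma sorted_list_of_multiset_nth_1_le_max:
  fixes x y :: "'a::linorder"
  assumes "{#x, y#} \<subseteq># M"
  shows "sorted_list_of_multiset M ! 1 \<le> max x y"
proof -
  define xs where "xs = sorted_list_of_multiset M"
  have M: "mset xs = M" and xs: "sorted xs"
    by (simp_all add: xs_def)
  have "size {#x, y#} \<le> size M"
    using assms by (rule size_mset_mono)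
  then have "2 \<le> length xs"
    using size_mset[of xs] M by simp
  then obtain a b ys where ys: "xs = a # b # ys"
    by (cases xs; cases "tl xs") auto
  have "b \<le> max x y"
  proof (rule ccontr)
    assume "\<not> b \<le> max x y"
    then have *: "x < b" "y < b" "\<And>z. z \<in> set ys \<Longrightarrow> b \<le> z"
      using xs ys by (auto simp: not_le)
    have "{#x, y#} \<subseteq># add_mset a (mset (b # ys))"
      using assms M ys by simp
    moreover have "count (mset (b # ys)) x = 0" "count (mset (b # ys)) y = 0"
      using * by (force simp: count_eq_zero_iff)+
    moreover have "count {#x, y#} x \<le> count (add_mset a (mset (b # ys))) x"
      "count {#x, y#} y \<le> count (add_mset a (mset (b # ys))) y"
      using calculation(1) by (simp_all only: mset_subset_eq_count)
    ultimately have "count {#x, y#} x \<le> count {#a#} x" "count {#x, y#} y \<le> count {#a#} y"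
      by (simp_all only: count_add_mset count_empty)
    then show False
      by (auto split: if_splits)
  qed
  then show ?thesis
    using ys by (simp add: xs_def)
qed

lemma symmetric_matrix_inner:
  fixes A :: "real^'n^'n"
  assumes "transpose A = A"
  shows "x \<bullet> (A *v y) = (A *v x) \<bullet> y"
  by (metis assms dot_lmul_matrix transpose_matrix_vector)

lemma inner_one_vec: "1 \<bullet> (x :: real^'n) = (\<Sum>i\<in>UNIV. x $ i)"
  by (simp add: inner_vec_def)

text \<open>Adding all rows of \<open>x I - A\<close> to row \<open>k\<close> turns that row into \<open>x\<close> times the all-ones row.
  This splits a factor \<open>x\<close> off the characteristic polynomial, and \<open>v\<close> makes the cofactor vanish
  at \<open>0\<close>.\<close>
lemma count_eigenvalues_0_ge_2:
  fixes A :: "real^'n^'n"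
  assumes col: "\<And>j. (\<Sum>i\<in>UNIV. A $ i $ j) = 0"
    and v: "v \<noteq> 0" "A *v v = 0" "(\<Sum>i\<in>UNIV. v $ i) = 0"
  shows "2 \<le> count (eigenvalues A) 0"
proof -
  obtain k :: 'n where True by simp
  \<comment> \<open>\<open>q\<close> is the cofactor as a polynomial; \<open>B x\<close> is the real
    matrix whose determinant is its value at \<open>x\<close>.\<close>
  define q where "q = det (\<chi> i j. if i = k then 1 else (if i = j then [:0, 1:] else 0) - [:A $ i $ j:])"
  define B where "B x = (\<chi> i. if i = k then (1 :: real^'n) else row i (mat x - A))" for x
  have q: "poly q x = det (B x)" for x
    unfolding q_def B_def det_def row_def
    by (auto simp: poly_sum poly_prod mat_def intro!: sum.cong prod.cong)
  have "det (mat x - A) = x * det (B x)" for x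
  proof -
    let ?M = "mat x - A"
    let ?s = "\<Sum>i\<in>UNIV - {k}. row i ?M"
    have "?s \<in> vec.span {row j ?M |j. j \<noteq> k}"
      by (intro vec.span_sum vec.span_base) auto
    then have "det ?M = det (\<chi> i. if i = k then row k ?M + ?s else row i ?M)"
      by (simp add: det_row_span)
    also have "row k ?M + ?s = (\<Sum>i\<in>UNIV. row i ?M)"
      by (simp add: sum.remove[of UNIV k])
    also have "\<dots> = x *s 1"
      by (simp add: vec_eq_iff row_def sum_subtractf col mat_def)
    finally show ?thesis
      unfolding B_def using det_row_mul[of k x "\<lambda>i. 1" "\<lambda>i. row i ?M"] by simp
  qed
  then have "poly (charpoly A) = poly ([:0, 1:] * q)"
    by (simp add: fun_eq_iff poly_charpoly q)
  then have cp: "charpoly A = [:0, 1:] * q"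
    by (simp only: poly_eq_poly_eq_iff)
  \<comment> \<open>At 0 the rows other than \<open>k\<close> are those of \<open>- A\<close>, which
    kill \<open>v\<close>; the all-ones row kills it because its entries sum to zero.\<close>
  have "(B 0 *v v) $ i = 0" for i
  proof (cases "i = k")
    case False
    then have "(B 0 *v v) $ i = - (A *v v) $ i"
      by (simp add: B_def matrix_vector_mult_def row_def mat_def sum_negf)
    then show ?thesis using v by simp
  qed (simp add: B_def matrix_vector_mult_def v)
  then have "B 0 *v v = 0"
    by (simp add: vec_eq_iff)
  then have "poly q 0 = 0"
    unfolding q using v(1) invertible_det_nz matrix_left_invertible_ker
      invertible_left_inverse by metis
  then have "[:0, 1:] dvd q"
    using poly_eq_0_iff_dvd[of q 0] by simp
  then have "[:- 0, 1:] ^ 2 dvd charpoly A"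
    unfolding cp by (simp add: power2_eq_square del: mult_pCons_left mult_pCons_right)
  then show ?thesis
    using charpoly_nonzero[of A] by (simp only: count_eigenvalues order_divides) simp
qed

subsection \<open>Positive semidefinite matrices and the Rayleigh quotient\<close>

text \<open>Otherwise a short move from \<open>u\<close> along \<open>- (M *v u)\<close> would make
  the form negative, since its first-order change is negative there.\<close>

lemma psd_quadratic_zero:
  fixes M :: "real^'n^'n"
  assumes sym: "transpose M = M" and psd: "\<And>x. 0 \<le> x \<bullet> (M *v x)" and u: "u \<bullet> (M *v u) = 0"
  shows "M *v u = 0"
proof (rule ccontr)
  assume nz: "M *v u \<noteq> 0"
  define w where "w = M *v u"
  define b where "b = w \<bullet> w"
  define c where "c = w \<bullet> (M *v w)"
  have b: "b > 0" using nz by (simp add: b_def w_def)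
  have c: "c \<ge> 0" by (simp add: c_def psd)
  have *: "0 \<le> 2 * s * b + s\<^sup>2 * c" for s
  proof -
    have "u \<bullet> (M *v w) = b"
      by (simp add: symmetric_matrix_inner[OF sym] b_def w_def)
    then show ?thesis
      using psd[of "u + s *\<^sub>R w"] u
      by (simp add: matrix_vector_right_distrib matrix_vector_mult_scaleR inner_add_left
          inner_add_right b_def c_def w_def power2_eq_square algebra_simps)
  qed
  \<comment> \<open>Chosen so that \<open>s * c < b\<close>, which contradicts
    \<open>2 * b \<le> s * c\<close>; the summand 1 covers \<open>c = 0\<close>.\<close>
  define s where "s = b / (c + 1)"
  have s: "s > 0" "s * (c + 1) = b"
    using b c by (simp_all add: s_def)
  have "0 \<le> s * (s * c - 2 * b)"
    using *[of "- s"] by (simp add: algebra_simps power2_eq_square)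
  then have "2 * b \<le> s * c"
    using s by (simp add: zero_le_mult_iff)
  then show False
    using s b by (simp add: algebra_simps)
qed

text \<open>The form is evaluated at \<open>b *\<^sub>R x - d *\<^sub>R y\<close>. As it may be
  degenerate, the case \<open>y \<bullet> (M *v y) = 0\<close> rests on
  \<open>psd_quadratic_zero\<close>.\<close>

lemma psd_Cauchy_Schwarz:
  fixes M :: "real^'n^'n"
  assumes sym: "transpose M = M" and psd: "\<And>x. 0 \<le> x \<bullet> (M *v x)"
  shows "(x \<bullet> (M *v y))\<^sup>2 \<le> (x \<bullet> (M *v x)) * (y \<bullet> (M *v y))"
proof (cases "y \<bullet> (M *v y) = 0")
  case True
  then show ?thesis using psd_quadratic_zero[OF sym psd True] by simp
next
  case False
  define b where "b = y \<bullet> (M *v y)"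
  define d where "d = x \<bullet> (M *v y)"
  have b: "b > 0" using False psd[of y] by (simp add: b_def)
  have d: "y \<bullet> (M *v x) = d"
    unfolding d_def by (metis symmetric_matrix_inner[OF sym] inner_commute)
  have "0 \<le> (b *\<^sub>R x - d *\<^sub>R y) \<bullet> (M *v (b *\<^sub>R x - d *\<^sub>R y))"
    by (rule psd)
  also have "\<dots> = b * (b * (x \<bullet> (M *v x)) - d * (x \<bullet> (M *v y))) - d * (b * (y \<bullet> (M *v x)) - d * (y \<bullet> (M *v y)))"
    by (simp add: matrix_vector_mult_diff_distrib matrix_vector_mult_scaleR inner_diff_left
        inner_diff_right algebra_simps)
  also have "\<dots> = b * (b * (x \<bullet> (M *v x)) - d\<^sup>2)"
    unfolding d b_def[symmetric] d_def[symmetric] by (simp add: power2_eq_square algebra_simps)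
  finally show ?thesis
    using b by (simp add: zero_le_mult_iff b_def d_def mult.commute)
qed

text \<open>Isolates what the spectral argument uses of the Laplacian of a connected graph; it is
  instantiated both at the limit and at nearby points.\<close>

locale graph_laplacian =
  fixes L :: "real^'n^'n"
  assumes sym: "transpose L = L" and psd: "0 \<le> x \<bullet> (L *v x)"
    and ker: "L *v x = 0 \<longleftrightarrow> (\<exists>c. x = c *\<^sub>R 1)"
begin

lemma one: "L *v 1 = 0"
  unfolding ker by (rule exI[of _ 1]) simp

lemma inner_one: "1 \<bullet> (L *v u) = 0"
  by (simp add: symmetric_matrix_inner[OF sym] one)

lemma surj_on_sum_zero:
  assumes h: "(\<Sum>i\<in>UNIV. h $ i) = 0"
  obtains u where "L *v u = h"
proof -
  \<comment> \<open>Adding the rank-one term removes the kernel of \<open>L\<close>: pairing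
    \<open>f u\<close> with \<open>1\<close> recovers \<open>1 \<bullet> u\<close>. For
    \<open>h\<close> of sum zero the added term vanishes at the preimage.\<close>
  define f where "f u = L *v u + (1 \<bullet> u) *\<^sub>R 1" for u :: "real^'n"
  have ones: "(1 :: real^'n) \<bullet> 1 > 0"
    by (simp add: inner_one_vec)
  have f1: "1 \<bullet> f u = (1 \<bullet> u) * (1 \<bullet> (1 :: real^'n))" for u
    by (simp add: f_def inner_add_right inner_one)
  have lin: "linear f"
    unfolding f_def
    by (intro linearI) (simp_all add: matrix_vector_right_distrib matrix_vector_mult_scaleR
        inner_add_right algebra_simps)
  have "u = 0" if "f u = 0" for u
  proof -
    have "1 \<bullet> u = 0"
      using f1[of u] ones that by simp
    then show ?thesis
      using that ker[of u] ones by (auto simp: f_def)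
  qed
  then have "inj f"
    using lin linear_injective_0 by blast
  then have "surj f"
    using lin linear_injective_imp_surjective by blast
  then obtain u where u: "f u = h"
    by (metis surjD)
  have "1 \<bullet> u = 0"
    using f1[of u] ones u h by (simp add: inner_one_vec)
  then have "L *v u = h"
    using u by (simp add: f_def)
  then show ?thesis ..
qed

text \<open>Minimising avoids diagonalising the nonsymmetric \<open>L ** H\<close>. With
  \<open>\<mu>\<close> the minimal quotient, \<open>M = L ** H ** L - \<mu> *\<^sub>R L\<close> is
  positive semidefinite and its form vanishes at the minimiser \<open>u0\<close>, so
  \<open>M *v u0 = 0\<close> and \<open>L *v u0\<close> is an eigenvector of \<open>L ** H\<close>
  for \<open>\<mu>\<close>. With the eigenvalue 0 this gives
  \<open>lambda_sec (L ** H) \<le> max 0 \<mu>\<close>, and positivity rules out the 0.\<close>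

lemma lambda_sec_Rayleigh:
  assumes card: "CARD('n) \<ge> 2" and symH: "transpose H = H"
    and pos: "lambda_sec (L ** H) > 0"
  shows "lambda_sec (L ** H) * (u \<bullet> (L *v u)) \<le> (L *v u) \<bullet> (H *v (L *v u))"
proof -
  define S where "S = {u :: real^'n. 1 \<bullet> u = 0} \<inter> sphere 0 1"
  define N where "N u = (L *v u) \<bullet> (H *v (L *v u))" for u
  define D where "D u = u \<bullet> (L *v u)" for u
  have Dpos: "D u > 0" if "1 \<bullet> u = 0" "u \<noteq> 0" for u
  proof -
    have "D u \<noteq> 0"
    proof
      assume "D u = 0"
      then obtain c where "u = c *\<^sub>R 1"
        using ker psd_quadratic_zero[OF sym psd, of u] by (auto simp: D_def)
      then show False using that by (simp add: inner_one_vec)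
    qed
    then show ?thesis using psd[of u] by (simp add: D_def)
  qed
  have "compact S"
    unfolding S_def by (intro closed_Int_compact closed_hyperplane compact_sphere)
  moreover have "S \<noteq> {}"
  proof -
    have "\<exists>i j :: 'n. i \<noteq> j"
      using card by (metis card_le_Suc0_iff_eq finite numeral_2_eq_2
          Suc_n_not_le_n le_trans)
    then obtain i j :: 'n where "i \<noteq> j" by blast
    define e :: "real^'n" where "e = axis i 1 - axis j 1"
    have "e $ i \<noteq> 0" using \<open>i \<noteq> j\<close> by (simp add: e_def axis_def)
    then have "e \<noteq> 0" by auto
    moreover have "1 \<bullet> e = 0"
      by (simp add: e_def inner_diff_right inner_axis)
    ultimately have "e /\<^sub>R norm e \<in> S" by (simp add: S_def)
    then show ?thesis by blast
  qed
  moreover have "continuous_on S (\<lambda>u. N u / D u)"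
    unfolding N_def D_def
    by (intro continuous_intros bounded_linear.continuous_on[OF matrix_vector_mul_bounded_linear] ballI)
      (use Dpos[unfolded D_def] in \<open>force simp: S_def\<close>)
  ultimately have "\<exists>u0\<in>S. \<forall>u\<in>S. N u0 / D u0 \<le> N u / D u"
    by (rule continuous_attains_inf)
  then obtain u0 where u0: "u0 \<in> S" and min: "\<And>u. u \<in> S \<Longrightarrow> N u0 / D u0 \<le> N u / D u"
    by blast
  define \<mu> where "\<mu> = N u0 / D u0"
  have u0': "1 \<bullet> u0 = 0" "u0 \<noteq> 0"
    using u0 by (auto simp: S_def)
  define M where "M = L ** H ** L - \<mu> *\<^sub>R L"
  have Mv: "M *v x = L *v (H *v (L *v x)) - \<mu> *\<^sub>R (L *v x)" for x
    by (simp add: M_def matrix_vector_mult_diff_rdistrib matrix_vector_mul_assoc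
        matrix_mul_assoc scaleR_matrix_vector_assoc)
  have quad: "x \<bullet> (M *v x) = N x - \<mu> * D x" for x
    by (simp add: Mv inner_diff_right N_def D_def symmetric_matrix_inner[OF sym])
  have symM: "transpose M = M"
  proof -
    have "transpose (L ** H ** L) = L ** H ** L"
      by (simp add: matrix_transpose_mul matrix_mul_assoc sym symH)
    then show ?thesis
      using sym by (simp add: M_def transpose_def vec_eq_iff)
  qed
  have psdM: "0 \<le> x \<bullet> (M *v x)" for x
  proof -
    \<comment> \<open>Subtracting the mean of \<open>x\<close> changes neither \<open>N\<close> nor
      \<open>D\<close>, and scaling does not change their quotient, so minimality on
      \<open>S\<close> suffices.\<close>
    define c where "c = (1 \<bullet> x) / (1 \<bullet> (1 :: real^'n))"
    define y where "y = x - c *\<^sub>R 1"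
    have y: "1 \<bullet> y = 0"
      by (simp add: y_def c_def inner_diff_right inner_one_vec)
    have Ly: "L *v y = L *v x"
      by (simp add: y_def matrix_vector_mult_diff_distrib matrix_vector_mult_scaleR one)
    have Dy: "D y = D x"
      unfolding D_def Ly by (simp add: y_def inner_diff_left inner_one)
    have "0 \<le> N y - \<mu> * D y"
    proof (cases "y = 0")
      case False
      define r where "r = 1 / norm y"
      have "r \<noteq> 0" using False by (simp add: r_def)
      have "r *\<^sub>R y \<in> S"
        using False y by (simp add: S_def r_def)
      then have "\<mu> \<le> N (r *\<^sub>R y) / D (r *\<^sub>R y)"
        using min by (simp add: \<mu>_def)
      also have "\<dots> = N y / D y"
        using \<open>r \<noteq> 0\<close> by (simp add: N_def D_def matrix_vector_mult_scaleR)
      finally show ?thesis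
        using Dpos[OF y False] by (simp add: field_simps)
    qed (simp add: N_def D_def)
    moreover have "N y = N x" by (simp add: N_def Ly)
    ultimately show ?thesis by (simp add: quad Dy)
  qed
  have "u0 \<bullet> (M *v u0) = 0"
    using Dpos[OF u0'] by (simp add: quad \<mu>_def)
  then have "M *v u0 = 0"
    by (rule psd_quadratic_zero[OF symM psdM])
  then have ev: "(L ** H) *v (L *v u0) = \<mu> *\<^sub>R (L *v u0)"
    by (simp add: Mv flip: matrix_vector_mul_assoc)
  have nz: "L *v u0 \<noteq> 0"
    using Dpos[OF u0'] by (auto simp: D_def)
  have col: "(\<Sum>i\<in>UNIV. (L ** H) $ i $ j) = 0" for j
  proof -
    have "(\<Sum>i\<in>UNIV. (L ** H) $ i $ j) = 1 \<bullet> ((L ** H) *v axis j 1)"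
      by (simp add: inner_one_vec matrix_vector_mul_component inner_axis)
    then show ?thesis by (simp add: inner_one flip: matrix_vector_mul_assoc)
  qed
  \<comment> \<open>If \<open>\<mu> = 0\<close>, the eigenvalue 0 must be counted twice:
    \<open>L *v u0\<close> is then a kernel vector of sum zero, and the columns of
    \<open>L ** H\<close> sum to zero.\<close>
  have "{#0, \<mu>#} \<subseteq># eigenvalues (L ** H)"
  proof (cases "\<mu> = 0")
    case True
    have "2 \<le> count (eigenvalues (L ** H)) 0"
      using ev nz inner_one[of u0] True
      by (intro count_eigenvalues_0_ge_2[OF col]) (auto simp: inner_one_vec)
    then show ?thesis using True by (simp add: subseteq_mset_def)
  next
    case False
    have "\<mu> \<in># eigenvalues (L ** H)"
      using ev nz by (auto simp: mem_eigenvalues_iff)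
    moreover have "0 \<in># eigenvalues (L ** H)"
    proof -
      have "det L = 0"
        using one invertible_det_nz[of L] matrix_left_invertible_ker[of L]
          invertible_left_inverse[of L] by (metis one_neq_zero)
      then have "det (L ** H) = 0"
        by (simp add: det_mul)
      then obtain v where "v \<noteq> 0" "(L ** H) *v v = 0"
        using invertible_det_nz[of "L ** H"] matrix_left_invertible_ker[of "L ** H"]
          invertible_left_inverse[of "L ** H"] by metis
      then show ?thesis by (auto simp: mem_eigenvalues_iff)
    qed
    ultimately show ?thesis
      using False by (simp add: subseteq_mset_def count_greater_zero_iff Suc_le_eq)
  qed
  then have "lambda_sec (L ** H) \<le> max 0 \<mu>"
    unfolding lambda_sec_def by (rule sorted_list_of_multiset_nth_1_le_max)
  then have "lambda_sec (L ** H) * D u \<le> \<mu> * D u"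
    using pos psd[of u] by (intro mult_right_mono) (auto simp: D_def)
  then show ?thesis
    using psdM[of u] by (simp add: quad N_def D_def)
qed

text \<open>Coercivity of \<open>H\<close> on vectors of sum zero, used later to absorb error terms
  of size \<open>h \<bullet> h\<close>. For \<open>h = L *v u\<close>, Cauchy-Schwarz for
  \<open>L\<close> gives \<open>h \<bullet> h \<le> K * (u \<bullet> h)\<close>, and the Rayleigh
  bound controls \<open>u \<bullet> h\<close>.\<close>

lemma Hessian_lower_bound:
  assumes card: "CARD('n) \<ge> 2" and symH: "transpose H = H"
    and pos: "lambda_sec (L ** H) > 0"
  obtains c where "c > 0"
    "\<And>h. (\<Sum>i\<in>UNIV. h $ i) = 0 \<Longrightarrow> c * (h \<bullet> h) \<le> h \<bullet> (H *v h)"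
proof
  define K where "K = onorm ((*v) L) + 1"
  define l where "l = lambda_sec (L ** H)"
  have K: "K > 0"
    using onorm_pos_le[OF matrix_vector_mul_bounded_linear, of L] by (simp add: K_def)
  show "l / K > 0" using pos K by (simp add: l_def)
  fix h :: "real^'n"
  assume "(\<Sum>i\<in>UNIV. h $ i) = 0"
  then obtain u where u: "L *v u = h" by (rule surj_on_sum_zero)
  have "h \<bullet> (L *v h) \<le> norm h * norm (L *v h)"
    by (rule norm_cauchy_schwarz)
  also have "\<dots> \<le> norm h * (K * norm h)"
    using onorm[OF matrix_vector_mul_bounded_linear, of L h]
    by (intro mult_left_mono) (simp_all add: K_def algebra_simps add_increasing)
  also have "\<dots> = K * (h \<bullet> h)"
    by (simp add: dot_square_norm power2_eq_square)
  finally have Lh: "h \<bullet> (L *v h) \<le> K * (h \<bullet> h)" .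
  have "(h \<bullet> h)\<^sup>2 \<le> (h \<bullet> (L *v h)) * (u \<bullet> h)"
    using psd_Cauchy_Schwarz[OF sym psd, of h u] by (simp add: u)
  also have "\<dots> \<le> (K * (h \<bullet> h)) * (u \<bullet> h)"
    using Lh psd[of u] by (intro mult_right_mono) (simp_all add: u)
  finally have "(h \<bullet> h) * (h \<bullet> h) \<le> (h \<bullet> h) * (K * (u \<bullet> h))"
    by (simp add: power2_eq_square algebra_simps)
  then have "h \<bullet> h \<le> K * (u \<bullet> h)"
    using inner_ge_zero[of h] psd[of u] K by (cases "h \<bullet> h = 0") (auto simp: u)
  then have "l * (h \<bullet> h) \<le> l * (K * (u \<bullet> h))"
    using pos by (simp add: l_def)
  also have "\<dots> \<le> K * (h \<bullet> (H *v h))"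
    using lambda_sec_Rayleigh[OF card symH pos, of u] K by (simp add: u l_def)
  finally show "l / K * (h \<bullet> h) \<le> h \<bullet> (H *v h)"
    using K by (simp add: field_simps)
qed

text \<open>Writing \<open>h = L *v u\<close> turns \<open>g \<bullet> h\<close> into an
  \<open>L\<close>-product, to which Cauchy-Schwarz applies; the Rayleigh bound then replaces
  \<open>u \<bullet> h\<close> by the Hessian form.\<close>

lemma dissipation_lower_bound:
  assumes card: "CARD('n) \<ge> 2" and symH: "transpose H = H"
    and pos: "lambda_sec (L ** H) > 0" and h: "(\<Sum>i\<in>UNIV. h $ i) = 0"
  shows "lambda_sec (L ** H) * (g \<bullet> h)\<^sup>2 \<le> (g \<bullet> (L *v g)) * (h \<bullet> (H *v h))"
proof -
  obtain u where u: "L *v u = h" using h by (rule surj_on_sum_zero)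
  have "lambda_sec (L ** H) * (g \<bullet> h)\<^sup>2
      \<le> lambda_sec (L ** H) * ((g \<bullet> (L *v g)) * (u \<bullet> h))"
    using psd_Cauchy_Schwarz[OF sym psd, of g u] pos by (intro mult_left_mono) (simp_all add: u)
  also have "\<dots> = (g \<bullet> (L *v g)) * (lambda_sec (L ** H) * (u \<bullet> (L *v u)))"
    by (simp add: u)
  also have "\<dots> \<le> (g \<bullet> (L *v g)) * (h \<bullet> (H *v h))"
    using lambda_sec_Rayleigh[OF card symH pos, of u] psd[of g]
    by (intro mult_left_mono) (simp_all add: u)
  finally show ?thesis .
qed

end

subsection \<open>Weighted Laplacian and free energy\<close>

text \<open>Summation by parts: averaging the double sum with its copy under the swap of
  \<open>i\<close> and \<open>j\<close> produces both differences and the factor 1/2.\<close>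

lemma inner_weighted_laplacian:
  assumes "weighted_graph E \<omega>"
  shows "x \<bullet> (weighted_laplacian E \<omega> \<rho> *v y) =
    1 / 2 * (\<Sum>i\<in>UNIV. \<Sum>j\<in>UNIV. \<omega> i j * theta \<rho> i j * ((x $ i - x $ j) * (y $ i - y $ j)))"
proof -
  have om: "\<omega> i j = \<omega> j i" "(i, j) \<notin> E \<Longrightarrow> \<omega> i j = 0" for i j
    using assms by (auto simp: weighted_graph_def)
  have th: "theta \<rho> i j = theta \<rho> j i" for i j
    by (simp add: theta_def)
  have L: "(weighted_laplacian E \<omega> \<rho> *v y) $ i =
      (\<Sum>j\<in>UNIV. \<omega> i j * theta \<rho> i j * (y $ i - y $ j))" for i
    unfolding weighted_laplacian_mult
    by (intro sum.mono_neutral_left) (auto simp: nbrs_def om(2))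
  define S where "S = x \<bullet> (weighted_laplacian E \<omega> \<rho> *v y)"
  have S1: "S = (\<Sum>i\<in>UNIV. \<Sum>j\<in>UNIV. \<omega> i j * theta \<rho> i j * (x $ i * (y $ i - y $ j)))"
    by (simp add: S_def inner_vec_def L sum_distrib_left ac_simps)
  also have "\<dots> = (\<Sum>i\<in>UNIV. \<Sum>j\<in>UNIV. \<omega> j i * theta \<rho> j i * (x $ j * (y $ j - y $ i)))"
    by (rule sum.swap)
  also have "\<dots> = (\<Sum>i\<in>UNIV. \<Sum>j\<in>UNIV. \<omega> i j * theta \<rho> i j * (x $ j * (y $ j - y $ i)))"
    by (simp add: om(1) th)
  finally have S2: "S = \<dots>" .
  have "S + S = (\<Sum>i\<in>UNIV. \<Sum>j\<in>UNIV. \<omega> i j * theta \<rho> i j * ((x $ i - x $ j) * (y $ i - y $ j)))"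
    by (subst S1, subst S2) (simp add: algebra_simps flip: sum.distrib)
  then show ?thesis by (simp add: S_def)
qed

lemma graph_laplacian_weighted_laplacian:
  assumes G: "weighted_graph E \<omega>" and pos: "\<And>i. \<rho> $ i > 0"
  shows "graph_laplacian (weighted_laplacian E \<omega> \<rho>)"
proof
  let ?L = "weighted_laplacian E \<omega> \<rho>"
  have th: "theta \<rho> i j > 0" for i j
    using pos[of i] pos[of j] by (simp add: theta_def)
  have om: "\<omega> i j \<ge> 0" and om_pos: "(i, j) \<in> E \<Longrightarrow> \<omega> i j > 0" and conn: "(i, j) \<in> E\<^sup>*" for i j
    using G by (auto simp: weighted_graph_def) (metis less_eq_real_def)
  have entry: "?L $ i $ j = axis i 1 \<bullet> (?L *v axis j 1)" for i j
    by (simp add: inner_axis' matrix_vector_mul_component inner_axis)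
  show "transpose ?L = ?L"
    by (simp add: transpose_def vec_eq_iff entry inner_weighted_laplacian[OF G] mult.commute)
  have nonneg: "0 \<le> \<omega> i j * theta \<rho> i j * ((x $ i - x $ j) * (x $ i - x $ j))" for x i j
    using om[of i j] th[of i j] by simp
  show "0 \<le> x \<bullet> (?L *v x)" for x
    unfolding inner_weighted_laplacian[OF G] by (simp add: sum_nonneg nonneg)
  show "?L *v x = 0 \<longleftrightarrow> (\<exists>c. x = c *\<^sub>R 1)" for x
  proof
    assume "?L *v x = 0"
    then have "x \<bullet> (?L *v x) = 0" by simp
    then have "\<omega> i j * theta \<rho> i j * ((x $ i - x $ j) * (x $ i - x $ j)) = 0" for i j
      unfolding inner_weighted_laplacian[OF G] by (simp add: sum_nonneg_eq_0_iff sum_nonneg nonneg)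
    then have edge: "x $ i = x $ j" if "(i, j) \<in> E" for i j
      using om_pos[OF that] th[of i j] by (metis eq_iff_diff_eq_0 less_irrefl mult_eq_0_iff)
    have "x $ i = x $ j" for i j
      using conn[of i j] by (induction rule: rtrancl_induct) (auto dest: edge)
    \<comment> \<open>All coordinates agree, so an arbitrary vertex supplies the constant.\<close>
    then have "x = (x $ undefined) *\<^sub>R 1" by (simp add: vec_eq_iff)
    then show "\<exists>c. x = c *\<^sub>R 1" ..
  next
    assume "\<exists>c. x = c *\<^sub>R 1"
    then show "?L *v x = 0" by (auto simp: vec_eq_iff weighted_laplacian_mult)
  qed
qed

text \<open>The weights \<open>theta\<close> are linear and monotone in the density, so a
  coordinatewise comparison passes to the edge form.\<close>

lemma weighted_laplacian_mono:
  assumes G: "weighted_graph E \<omega>" and le: "\<And>i. r * a $ i \<le> \<rho> $ i"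
  shows "r * (x \<bullet> (weighted_laplacian E \<omega> a *v x)) \<le> x \<bullet> (weighted_laplacian E \<omega> \<rho> *v x)"
proof -
  have om: "\<omega> i j \<ge> 0" for i j
    using G by (auto simp: weighted_graph_def) (metis less_eq_real_def)
  have th: "r * theta a i j \<le> theta \<rho> i j" for i j
    using le[of i] le[of j] by (simp add: theta_def field_simps)
  have "r * (\<omega> i j * theta a i j * ((x $ i - x $ j) * (x $ i - x $ j)))
      \<le> \<omega> i j * theta \<rho> i j * ((x $ i - x $ j) * (x $ i - x $ j))" for i j
    using mult_right_mono[OF mult_left_mono[OF th[of i j] om[of i j]],
        of "(x $ i - x $ j) * (x $ i - x $ j)"] by (simp add: ac_simps)
  then have "(\<Sum>i\<in>UNIV. \<Sum>j\<in>UNIV. r * (\<omega> i j * theta a i j * ((x $ i - x $ j) * (x $ i - x $ j))))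
      \<le> (\<Sum>i\<in>UNIV. \<Sum>j\<in>UNIV. \<omega> i j * theta \<rho> i j * ((x $ i - x $ j) * (x $ i - x $ j)))"
    by (intro sum_mono)
  then show ?thesis
    unfolding inner_weighted_laplacian[OF G] by (simp flip: sum_distrib_left)
qed

text \<open>The gradient of the free energy, up to the additive constant \<open>\<beta>\<close>, which the
  Laplacian kills.\<close>
definition potential :: "real^'n^'n \<Rightarrow> real^'n \<Rightarrow> real \<Rightarrow> real^'n \<Rightarrow> real^'n" where
  "potential W V \<beta> \<rho> = W *v \<rho> + V + \<beta> *\<^sub>R (\<chi> i. ln (\<rho> $ i))"

lemma fp_rhs_eq: "fp_rhs E \<omega> W V \<beta> \<rho> = - (weighted_laplacian E \<omega> \<rho> *v potential W V \<beta> \<rho>)"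
  by (simp add: vec_eq_iff fp_rhs_def weighted_laplacian_mult potential_def sum_distrib_left
      algebra_simps flip: sum.distrib sum_negf sum_subtractf)

text \<open>The full gradient is \<open>potential\<close> plus \<open>\<beta>\<close> in every
  coordinate, from the derivative of \<open>x * ln x\<close>; hence the second term, which vanishes
  along the flow because mass is conserved.\<close>

lemma free_energy_has_derivative:
  assumes sym: "transpose W = W" and pos: "\<And>i. \<rho> t $ i > 0"
    and \<rho>: "(\<rho> has_vector_derivative D) (at t within S)"
  shows "((\<lambda>t. free_energy W V \<beta> (\<rho> t)) has_real_derivative
    potential W V \<beta> (\<rho> t) \<bullet> D + \<beta> * (1 \<bullet> D)) (at t within S)"
proof -
  have comp: "((\<lambda>t. \<rho> t $ i) has_real_derivative D $ i) (at t within S)" for i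
    using bounded_linear.has_vector_derivative[OF bounded_linear_vec_nth \<rho>]
    by (simp add: has_real_derivative_iff_has_vector_derivative)
  have WD: "((\<lambda>t. (W *v \<rho> t) $ i) has_real_derivative (W *v D) $ i) (at t within S)" for i
    unfolding matrix_vector_mult_def
    by (auto intro!: derivative_eq_intros comp sum.cong)
  have "((\<lambda>t. 1 / 2 * (\<Sum>i\<in>UNIV. \<rho> t $ i * (W *v \<rho> t) $ i) + (\<Sum>i\<in>UNIV. V $ i * \<rho> t $ i)
      + \<beta> * (\<Sum>i\<in>UNIV. \<rho> t $ i * ln (\<rho> t $ i))) has_real_derivative
      1 / 2 * (\<Sum>i\<in>UNIV. D $ i * (W *v \<rho> t) $ i + (W *v D) $ i * \<rho> t $ i)
      + (\<Sum>i\<in>UNIV. D $ i * V $ i)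
      + \<beta> * (\<Sum>i\<in>UNIV. D $ i * ln (\<rho> t $ i) + 1 / \<rho> t $ i * D $ i * \<rho> t $ i)) (at t within S)"
    by (intro DERIV_add DERIV_cmult DERIV_sum DERIV_mult comp WD DERIV_cmult_right
        DERIV_chain2[where f=ln] derivative_eq_intros refl)
      (use pos comp in \<open>auto simp: mult.commute\<close>)
  moreover have "(\<Sum>i\<in>UNIV. (W *v D) $ i * \<rho> t $ i) = (\<Sum>i\<in>UNIV. D $ i * (W *v \<rho> t) $ i)"
    using symmetric_matrix_inner[OF sym, of D "\<rho> t"] by (simp add: inner_vec_def)
  moreover have "potential W V \<beta> (\<rho> t) \<bullet> D = (\<Sum>i\<in>UNIV. D $ i * (W *v \<rho> t) $ i)
      + (\<Sum>i\<in>UNIV. D $ i * V $ i) + \<beta> * (\<Sum>i\<in>UNIV. D $ i * ln (\<rho> t $ i))"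
    by (simp add: inner_vec_def potential_def algebra_simps sum.distrib sum_distrib_left)
  moreover have "1 / \<rho> t $ i * D $ i * \<rho> t $ i = D $ i" for i
    using pos[of i] by simp
  ultimately show ?thesis
    by (simp add: free_energy_def inner_vec_def[of "\<rho> _"] inner_vec_def[of V] inner_one_vec
        sum.distrib distrib_left add.assoc)
qed

subsection \<open>Decay\<close>

text \<open>Above \<open>a\<close>, the increment of \<open>ln\<close> is at least
  \<open>(x - a) / x\<close>, and \<open>(1 - k) * (1 + k) \<le> 1\<close> converts
  \<open>1 / x\<close> into \<open>(1 - k) / a\<close>. Below \<open>a\<close>, concavity gives even
  the factor 1.\<close>

lemma ln_monotone_lower:
  fixes a x k :: real
  assumes "0 < a" "0 < x" "x \<le> (1 + k) * a" "0 \<le> k"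
  shows "(1 - k) * ((x - a)\<^sup>2 / a) \<le> (x - a) * (ln x - ln a)"
proof (cases "a \<le> x")
  case True
  have "(1 - k) * x \<le> a"
  proof (cases "k \<le> 1")
    case True
    have "(1 - k) * x \<le> (1 - k) * ((1 + k) * a)"
      using True assms by (intro mult_left_mono) auto
    also have "\<dots> = a - k\<^sup>2 * a"
      by (simp add: algebra_simps power2_eq_square)
    also have "\<dots> \<le> a" using assms by simp
    finally show ?thesis .
  next
    case False
    then have "(1 - k) * x \<le> 0" using assms by (simp add: mult_le_0_iff)
    then show ?thesis using assms by linarith
  qed
  then have "(1 - k) / a \<le> 1 / x"
    using assms by (simp add: field_simps)
  then have "(x - a)\<^sup>2 * ((1 - k) / a) \<le> (x - a)\<^sup>2 * (1 / x)"
    by (rule mult_left_mono) simp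
  also have "\<dots> = (x - a) * ((x - a) / x)"
    by (simp add: power2_eq_square)
  also have "\<dots> \<le> (x - a) * (ln x - ln a)"
    using ln_diff_le[of a x] assms True
    by (intro mult_left_mono) (simp_all add: field_simps)
  finally show ?thesis by (simp add: ac_simps)
next
  case False
  have "(1 - k) * ((x - a)\<^sup>2 / a) \<le> (x - a) * ((x - a) / a)"
    using assms mult_right_mono[of "1 - k" 1 "(x - a)\<^sup>2 / a"] by (simp add: power2_eq_square)
  also have "\<dots> \<le> (x - a) * (ln x - ln a)"
    using ln_diff_le[of x a] assms False by (intro mult_left_mono_neg) simp_all
  finally show ?thesis .
qed

text \<open>Second-order Taylor bound: the second derivative \<open>1 / y\<close> is at most
  \<open>1 / m\<close>. The difference \<open>g\<close> of the two sides vanishes at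
  \<open>a\<close> and is smallest there.\<close>

lemma x_ln_x_upper:
  fixes a x m :: real
  assumes "0 < m" "m \<le> a" "m \<le> x"
  shows "x * ln x \<le> a * ln a + (ln a + 1) * (x - a) + (x - a)\<^sup>2 / (2 * m)"
proof -
  define g where "g y = a * ln a + (ln a + 1) * (y - a) + (y - a)\<^sup>2 / (2 * m) - y * ln y" for y
  have g': "(g has_real_derivative ln a + (y - a) / m - ln y) (at y)" if "y > 0" for y
    unfolding g_def using that assms
    by (auto intro!: derivative_eq_intros simp: field_simps)
  have "g a \<le> g x"
  proof (cases "a \<le> x")
    case True
    show ?thesis
    proof (rule DERIV_nonneg_imp_nondecreasing[OF True])
      fix y assume y: "a \<le> y" "y \<le> x"
      have "ln y - ln a \<le> (y - a) / a"
        using y assms by (intro ln_diff_le) auto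
      also have "\<dots> \<le> (y - a) / m"
        using y assms by (intro divide_left_mono) auto
      finally show "\<exists>d. (g has_real_derivative d) (at y) \<and> 0 \<le> d"
        using g'[of y] y assms by (intro exI[of _ "ln a + (y - a) / m - ln y"] conjI) auto
    qed
  next
    case False
    then have "x \<le> a" by simp
    then show ?thesis
    proof (rule DERIV_nonpos_imp_nonincreasing)
      fix y assume y: "x \<le> y" "y \<le> a"
      have "ln a - ln y \<le> (a - y) / y"
        using y assms by (intro ln_diff_le) auto
      also have "\<dots> \<le> (a - y) / m"
        using y assms by (intro divide_left_mono) auto
      also have "\<dots> = - ((y - a) / m)"
        by (simp add: minus_divide_left)
      finally show "\<exists>d. (g has_real_derivative d) (at y) \<and> d \<le> 0"
        using g'[of y] y assms by (intro exI[of _ "ln a + (y - a) / m - ln y"] conjI) auto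
    qed
  qed
  then show ?thesis by (simp add: g_def)
qed

lemma Gronwall_decay:
  fixes f :: "real \<Rightarrow> real"
  assumes f: "\<And>t. T \<le> t \<Longrightarrow> (f has_real_derivative f' t) (at t)"
    and le: "\<And>t. T \<le> t \<Longrightarrow> f' t \<le> - k * f t" and "T \<le> t"
  shows "f t \<le> exp (- k * (t - T)) * f T"
proof -
  have "exp (k * t) * f t \<le> exp (k * T) * f T"
  proof (rule DERIV_nonpos_imp_nonincreasing[OF \<open>T \<le> t\<close>])
    fix s assume "T \<le> s" "s \<le> t"
    then have "((\<lambda>s. exp (k * s) * f s) has_real_derivative exp (k * s) * (k * f s + f' s)) (at s)"
      by (auto intro!: derivative_eq_intros f simp: algebra_simps)
    moreover have "exp (k * s) * (k * f s + f' s) \<le> 0"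
      using le[OF \<open>T \<le> s\<close>] by (simp add: mult_le_0_iff)
    ultimately show "\<exists>y. ((\<lambda>s. exp (k * s) * f s) has_real_derivative y) (at s) \<and> y \<le> 0"
      by blast
  qed
  then show ?thesis
    by (simp add: algebra_simps exp_diff exp_minus field_simps)
qed

text \<open>The energy gap is bounded above by \<open>Q h\<close>, the dissipation below via
  \<open>g \<bullet> h\<close>. Closeness is measured relative to each \<open>a $ i\<close>, which
  suits both the Laplacian comparison and the logarithms.\<close>

lemma free_energy_dissipation_near:
  fixes W :: "real^'n^'n" and E :: "('n::finite \<times> 'n) set"
  assumes card: "CARD('n) \<ge> 2" and G: "weighted_graph E \<omega>" and W: "transpose W = W"
    and \<beta>: "\<beta> > 0" and eq: "a \<in> fp_equilibria E \<omega> W V \<beta>"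
    and lam: "lam = lambda_sec (weighted_laplacian E \<omega> a ** Hess (free_energy W V \<beta>) a)" "lam > 0"
    and \<epsilon>: "0 < \<epsilon>" "\<epsilon> < lam"
  obtains k where "k > 0"
    "\<And>\<rho>. \<rho> \<in> prob_interior \<Longrightarrow> \<forall>i. \<bar>\<rho> $ i - a $ i\<bar> \<le> k * a $ i \<Longrightarrow>
      2 * (lam - \<epsilon>) * (free_energy W V \<beta> \<rho> - free_energy W V \<beta> a)
      \<le> potential W V \<beta> \<rho> \<bullet> (weighted_laplacian E \<omega> \<rho> *v potential W V \<beta> \<rho>)"
proof -
  define L where "L = weighted_laplacian E \<omega>"
  define H where "H = Hess (free_energy W V \<beta>) a"
  have a: "a $ i > 0" "(\<Sum>i\<in>UNIV. a $ i) = 1" for i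
    using eq by (auto simp: fp_equilibria_def prob_interior_def)
  interpret a: graph_laplacian "L a"
    unfolding L_def using a by (intro graph_laplacian_weighted_laplacian G)
  have "L a *v potential W V \<beta> a = 0"
    using eq by (simp add: fp_equilibria_def fp_rhs_eq L_def)
  then obtain c where c: "potential W V \<beta> a = c *\<^sub>R 1"
    using a.ker by blast
  have H: "H = W + \<beta> *\<^sub>R (\<chi> i j. if i = j then 1 / a $ i else 0)"
    unfolding H_def using a by (intro Hess_free_energy[OF W])
  have symH: "transpose H = H"
    using W by (simp add: H transpose_def vec_eq_iff)
  \<comment> \<open>\<open>P\<close> is the entropy part of the Hessian form \<open>Q\<close>. The
    \<open>W\<close> part of the energy is exactly quadratic, so all expansion errors are multiples
    of \<open>k * P h\<close>.\<close>
  define P where "P h = \<beta> * (\<Sum>i\<in>UNIV. (h $ i)\<^sup>2 / a $ i)" for h :: "real^'n"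
  define Q where "Q h = h \<bullet> (H *v h)" for h
  have Q: "Q h = h \<bullet> (W *v h) + P h" for h
  proof -
    have "(\<chi> i j. if i = j then 1 / a $ i else 0) *v h = (\<chi> i. h $ i / a $ i)"
      by (simp add: vec_eq_iff matrix_vector_mult_def if_distrib if_distribR cong: if_cong)
    then have "H *v h = W *v h + \<beta> *\<^sub>R (\<chi> i. h $ i / a $ i)"
      by (simp add: H matrix_vector_mult_add_rdistrib flip: scaleR_matrix_vector_assoc)
    then show ?thesis
      by (simp add: Q_def P_def inner_add_right) (simp add: inner_vec_def power2_eq_square)
  qed
  have P_nonneg: "P h \<ge> 0" for h
    unfolding P_def using \<beta> a(1) by (intro mult_nonneg_nonneg sum_nonneg divide_nonneg_pos) auto
  define M where "M = \<beta> * (\<Sum>i\<in>UNIV. 1 / a $ i)"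
  have M: "M > 0"
    unfolding M_def using \<beta> a(1) by (intro mult_pos_pos sum_pos) auto
  have P_le: "P h \<le> M * (h \<bullet> h)" for h
  proof -
    have "(h $ i)\<^sup>2 / a $ i \<le> (h \<bullet> h) * (1 / a $ i)" for i
      using a(1)[of i] member_le_sum[of i UNIV "\<lambda>i. (h $ i)\<^sup>2"]
      by (simp add: divide_right_mono inner_vec_def power2_eq_square)
    then have "(\<Sum>i\<in>UNIV. (h $ i)\<^sup>2 / a $ i) \<le> (\<Sum>i\<in>UNIV. (h \<bullet> h) * (1 / a $ i))"
      by (rule sum_mono)
    also have "\<dots> = (h \<bullet> h) * (\<Sum>i\<in>UNIV. 1 / a $ i)"
      by (rule sum_distrib_left[symmetric])
    finally have "P h \<le> \<beta> * \<dots>"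
      using \<beta> by (simp add: P_def)
    then show ?thesis by (simp add: M_def ac_simps)
  qed
  have lam': "lambda_sec (L a ** H) = lam" "lambda_sec (L a ** H) > 0"
    using lam by (simp_all add: H_def L_def)
  obtain b where b: "b > 0" "\<And>h. (\<Sum>i\<in>UNIV. h $ i) = 0 \<Longrightarrow> b * (h \<bullet> h) \<le> Q h"
    using a.Hessian_lower_bound[OF card symH lam'(2)] unfolding Q_def by blast
  \<comment> \<open>The estimates below lose a factor \<open>(1 - \<delta>)\<^sup>3 / (1 + \<delta>) \<ge> 1 - 4 * \<delta>\<close>.\<close>
  define \<delta> where "\<delta> = \<epsilon> / (4 * lam)"
  have \<delta>: "0 < \<delta>" "\<delta> < 1 / 4" "lam * (1 - 4 * \<delta>) = lam - \<epsilon>"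
    using \<epsilon> by (auto simp: \<delta>_def field_simps)
  \<comment> \<open>The first bound serves the comparison of the Laplacians. The second yields
    \<open>2 * k * P h \<le> \<delta> * Q h\<close> through coercivity; as \<open>W\<close> may be
    indefinite, \<open>Q\<close> need not dominate \<open>P\<close>.\<close>
  define k where "k = min \<delta> (\<delta> * b / (2 * M))"
  have k: "0 < k" "k \<le> \<delta>" "2 * k * M \<le> \<delta> * b"
    using \<delta> b M by (auto simp: k_def min_def field_simps)
  have "2 * (lam - \<epsilon>) * (free_energy W V \<beta> \<rho> - free_energy W V \<beta> a)
      \<le> potential W V \<beta> \<rho> \<bullet> (L \<rho> *v potential W V \<beta> \<rho>)"
    if \<rho>: "\<rho> \<in> prob_interior" and near: "\<forall>i. \<bar>\<rho> $ i - a $ i\<bar> \<le> k * a $ i" for \<rho>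
  proof -
    have \<rho>_pos: "\<rho> $ i > 0" for i
      using \<rho> by (simp add: prob_interior_def)
    interpret \<rho>: graph_laplacian "L \<rho>"
      unfolding L_def using \<rho>_pos by (intro graph_laplacian_weighted_laplacian G)
    define h where "h = \<rho> - a"
    have h: "(\<Sum>i\<in>UNIV. h $ i) = 0"
      using \<rho> a(2) by (simp add: h_def sum_subtractf prob_interior_def)
    have low: "(1 - k) * a $ i \<le> \<rho> $ i" and up: "\<rho> $ i \<le> (1 + k) * a $ i" for i
      using near[rule_format, of i] by (simp_all add: algebra_simps abs_le_iff)
    have Qpos: "Q h \<ge> 0"
      using b(2)[OF h] b(1) by (meson inner_ge_zero less_imp_le mult_nonneg_nonneg order.trans)
    have kP: "2 * k * P h \<le> \<delta> * Q h"
    proof -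
      have "2 * k * P h \<le> (2 * k * M) * (h \<bullet> h)"
        using P_le[of h] k by simp
      also have "\<dots> \<le> \<delta> * (b * (h \<bullet> h))"
        using mult_right_mono[OF k(3) inner_ge_zero[of h]] by (simp add: ac_simps)
      also have "\<dots> \<le> \<delta> * Q h"
        using b(2)[OF h] \<delta> by simp
      finally show ?thesis .
    qed
    define g where "g = potential W V \<beta> \<rho> - potential W V \<beta> a"
    \<comment> \<open>The potential at the equilibrium is constant, so \<open>L \<rho>\<close> does
      not see its subtraction.\<close>
    have dissipation: "potential W V \<beta> \<rho> \<bullet> (L \<rho> *v potential W V \<beta> \<rho>) = g \<bullet> (L \<rho> *v g)"
    proof -
      have "potential W V \<beta> \<rho> = g + c *\<^sub>R 1"
        by (simp add: g_def c)
      then show ?thesis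
        by (simp add: matrix_vector_right_distrib matrix_vector_mult_scaleR \<rho>.one inner_add_left
            \<rho>.inner_one)
    qed
    have gh: "(1 - \<delta>) * Q h \<le> g \<bullet> h"
    proof -
      have "(1 - k) * P h = \<beta> * (\<Sum>i\<in>UNIV. (1 - k) * ((\<rho> $ i - a $ i)\<^sup>2 / a $ i))"
        by (simp add: P_def h_def sum_distrib_left mult.left_commute)
      also have "\<dots> \<le> \<beta> * (\<Sum>i\<in>UNIV. (\<rho> $ i - a $ i) * (ln (\<rho> $ i) - ln (a $ i)))"
        using \<beta> a(1) \<rho>_pos up k(1)
        by (intro mult_left_mono sum_mono ln_monotone_lower) (auto intro: less_imp_le)
      also have "\<dots> = g \<bullet> h - h \<bullet> (W *v h)"
        by (simp add: g_def h_def potential_def matrix_vector_mult_diff_distrib inner_vec_def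
            sum_distrib_left algebra_simps flip: sum.distrib sum_subtractf)
      finally have "Q h - k * P h \<le> g \<bullet> h"
        by (simp add: Q algebra_simps)
      moreover have "k * P h \<le> \<delta> * Q h"
        using kP mult_nonneg_nonneg[OF less_imp_le[OF k(1)] P_nonneg[of h]] by linarith
      ultimately show ?thesis by (simp add: algebra_simps)
    qed
    have F: "2 * (free_energy W V \<beta> \<rho> - free_energy W V \<beta> a) \<le> (1 + \<delta>) * Q h"
    proof -
      have "\<rho> $ i * ln (\<rho> $ i) \<le> a $ i * ln (a $ i) + (ln (a $ i) + 1) * h $ i
          + (1 + 2 * k) / 2 * ((h $ i)\<^sup>2 / a $ i)" for i
      proof -
        have m: "0 < (1 - k) * a $ i" "(1 - k) * a $ i \<le> a $ i"
          using a(1)[of i] k \<delta> by (simp_all add: mult_left_le_one_le)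
        \<comment> \<open>With \<open>m = (1 - k) * a $ i\<close> the Taylor bound carries
          \<open>1 / (1 - k)\<close>, which is at most \<open>1 + 2 * k\<close> because
          \<open>k\<close> is below 1/2.\<close>
        have "0 \<le> k * (1 - 2 * k)" using k \<delta> by simp
        then have "1 \<le> (1 + 2 * k) * (1 - k)" by (simp add: algebra_simps)
        then have "1 / (1 - k) \<le> 1 + 2 * k"
          using k \<delta> by (simp add: pos_divide_le_eq)
        then have "1 / (1 - k) * ((h $ i)\<^sup>2 / a $ i / 2) \<le> (1 + 2 * k) * ((h $ i)\<^sup>2 / a $ i / 2)"
          using a(1)[of i] by (intro mult_right_mono) simp_all
        then show ?thesis
          using x_ln_x_upper[OF m low[of i]] by (simp add: h_def ac_simps)
      qed
      then have "(\<Sum>i\<in>UNIV. \<rho> $ i * ln (\<rho> $ i)) \<le> (\<Sum>i\<in>UNIV. a $ i * ln (a $ i)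
          + (ln (a $ i) + 1) * h $ i + (1 + 2 * k) / 2 * ((h $ i)\<^sup>2 / a $ i))"
        by (rule sum_mono)
      also have "\<dots> = (\<Sum>i\<in>UNIV. a $ i * ln (a $ i)) + (\<Sum>i\<in>UNIV. ln (a $ i) * h $ i)
          + (1 + 2 * k) / 2 * (\<Sum>i\<in>UNIV. (h $ i)\<^sup>2 / a $ i)"
        unfolding sum.distrib sum_distrib_left[symmetric] distrib_right using h by (simp add: sum.distrib)
      finally have "\<beta> * (\<Sum>i\<in>UNIV. \<rho> $ i * ln (\<rho> $ i)) \<le> \<beta> * \<dots>"
        using \<beta> by simp
      then have ent: "\<beta> * (\<Sum>i\<in>UNIV. \<rho> $ i * ln (\<rho> $ i)) \<le> \<beta> * (\<Sum>i\<in>UNIV. a $ i * ln (a $ i))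
          + \<beta> * (\<Sum>i\<in>UNIV. ln (a $ i) * h $ i) + (1 + 2 * k) / 2 * P h"
        by (simp add: P_def algebra_simps)
      \<comment> \<open>Criticality of \<open>a\<close> along vectors of sum zero cancels every
        first-order term of the energy gap.\<close>
      have "0 = potential W V \<beta> a \<bullet> h"
        using h by (simp add: c inner_one_vec)
      also have "\<dots> = (W *v a) \<bullet> h + V \<bullet> h + \<beta> * (\<Sum>i\<in>UNIV. ln (a $ i) * h $ i)"
        by (simp add: potential_def inner_add_left) (simp add: inner_vec_def)
      finally have crit: "\<beta> * (\<Sum>i\<in>UNIV. ln (a $ i) * h $ i) = - ((W *v a) \<bullet> h) - V \<bullet> h"
        by simp
      have \<rho>h: "\<rho> = a + h" by (simp add: h_def)
      have quad: "\<rho> \<bullet> (W *v \<rho>) = a \<bullet> (W *v a) + 2 * ((W *v a) \<bullet> h) + h \<bullet> (W *v h)"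
        unfolding \<rho>h using symmetric_matrix_inner[OF W, of a h]
        by (simp add: matrix_vector_right_distrib inner_add_left inner_add_right inner_commute)
      have "V \<bullet> \<rho> = V \<bullet> a + V \<bullet> h"
        by (simp add: \<rho>h inner_add_right)
      moreover have "(1 + 2 * k) / 2 * P h = P h / 2 + k * P h"
        by (simp add: algebra_simps add_divide_distrib)
      ultimately have "2 * (free_energy W V \<beta> \<rho> - free_energy W V \<beta> a) \<le> Q h + 2 * k * P h"
        using ent crit quad unfolding free_energy_def Q by argo
      then show ?thesis using kP by (simp add: algebra_simps)
    qed
    have D1: "(1 - \<delta>) * (g \<bullet> (L a *v g)) \<le> g \<bullet> (L \<rho> *v g)"
      unfolding L_def
    proof (rule weighted_laplacian_mono[OF G])
      fix i
      have "(1 - \<delta>) * a $ i \<le> (1 - k) * a $ i"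
        using k a(1)[of i] by (intro mult_right_mono) auto
      then show "(1 - \<delta>) * a $ i \<le> \<rho> $ i" using low[of i] by linarith
    qed
    \<comment> \<open>Both sides are multiplied by \<open>Q h\<close> to use the dissipation bound;
      where \<open>Q h = 0\<close>, semidefiniteness suffices.\<close>
    have D2: "lam * (1 - \<delta>)\<^sup>2 * Q h \<le> g \<bullet> (L a *v g)"
    proof (cases "Q h = 0")
      case True
      then show ?thesis by (simp add: a.psd)
    next
      case False
      have "lam * ((1 - \<delta>) * Q h)\<^sup>2 \<le> lam * (g \<bullet> h)\<^sup>2"
        using gh Qpos \<delta> lam(2) by (intro mult_left_mono power_mono) auto
      also have "\<dots> \<le> (g \<bullet> (L a *v g)) * Q h"
        using a.dissipation_lower_bound[OF card symH lam'(2) h, of g] by (simp add: lam' Q_def)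
      finally have "(lam * (1 - \<delta>)\<^sup>2 * Q h) * Q h \<le> (g \<bullet> (L a *v g)) * Q h"
        by (simp add: power_mult_distrib power2_eq_square ac_simps)
      then show ?thesis using False Qpos by simp
    qed
    have "2 * (lam - \<epsilon>) * (free_energy W V \<beta> \<rho> - free_energy W V \<beta> a)
        \<le> (lam - \<epsilon>) * ((1 + \<delta>) * Q h)"
      using mult_left_mono[OF F, of "lam - \<epsilon>"] \<epsilon> by (simp add: algebra_simps)
    also have "\<dots> = lam * ((1 - 4 * \<delta>) * (1 + \<delta>)) * Q h"
      by (simp flip: \<delta>(3))
    also have "\<dots> \<le> lam * (1 - \<delta>) ^ 3 * Q h"
    proof -
      have "(1 - \<delta>) ^ 3 - (1 - 4 * \<delta>) * (1 + \<delta>) = \<delta>\<^sup>2 * (7 - \<delta>)"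
        by (simp add: algebra_simps power2_eq_square power3_eq_cube)
      moreover have "\<delta>\<^sup>2 * (7 - \<delta>) \<ge> 0" using \<delta> by simp
      ultimately have "(1 - 4 * \<delta>) * (1 + \<delta>) \<le> (1 - \<delta>) ^ 3" by linarith
      then show ?thesis using lam(2) Qpos by (intro mult_right_mono mult_left_mono) auto
    qed
    also have "\<dots> = (1 - \<delta>) * (lam * (1 - \<delta>)\<^sup>2 * Q h)"
      by (simp add: power2_eq_square power3_eq_cube)
    also have "\<dots> \<le> (1 - \<delta>) * (g \<bullet> (L a *v g))"
      using D2 \<delta> by (intro mult_left_mono) auto
    also have "\<dots> \<le> g \<bullet> (L \<rho> *v g)" by (rule D1)
    finally show ?thesis by (simp add: dissipation)
  qed
  then show ?thesis using that k(1) unfolding L_def by blast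
qed

theorem theorem11:
  fixes E :: "('n::finite \<times> 'n) set" and \<omega> :: "'n \<Rightarrow> 'n \<Rightarrow> real"
    and W :: "real^'n^'n" and V :: "real^'n" and \<beta> :: real
    and \<rho>0 \<rho>inf :: "real^'n" and \<rho> :: "real \<Rightarrow> real^'n" and lam :: real
  assumes "CARD('n) \<ge> 2"
    and "weighted_graph E \<omega>"
    and "transpose W = W"
    and "\<beta> > 0"
    and "\<rho>0 \<in> prob_interior"
    and "fp_solution E \<omega> W V \<beta> \<rho>0 \<rho>"
    and "(\<rho> \<longlongrightarrow> \<rho>inf) at_top"
    and "\<rho>inf isolated_in fp_equilibria E \<omega> W V \<beta>"
    and "lam = lambda_sec (weighted_laplacian E \<omega> \<rho>inf ** Hess (free_energy W V \<beta>) \<rho>inf)"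
    and "lam > 0"
  shows "\<exists>\<epsilon>0>0. \<forall>\<epsilon>. 0 < \<epsilon> \<and> \<epsilon> < \<epsilon>0 \<and> lam - \<epsilon> > 0 \<longrightarrow>
           (\<exists>T>0. \<forall>t>T.
              free_energy W V \<beta> (\<rho> t) - free_energy W V \<beta> \<rho>inf
              \<le> exp (- 2 * (lam - \<epsilon>) * (t - T)) *
                (free_energy W V \<beta> \<rho>0 - free_energy W V \<beta> \<rho>inf))"
proof -
  define F where "F t = free_energy W V \<beta> (\<rho> t)" for t
  define D where "D t = potential W V \<beta> (\<rho> t) \<bullet> (weighted_laplacian E \<omega> (\<rho> t) *v potential W V \<beta> (\<rho> t))" for t
  have sol: "\<rho> t \<in> prob_interior"
    "(\<rho> has_vector_derivative fp_rhs E \<omega> W V \<beta> (\<rho> t)) (at t within {0..})" if "t \<ge> 0" for t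
    using assms(6) that by (auto simp: fp_solution_def)
  have lap: "graph_laplacian (weighted_laplacian E \<omega> (\<rho> t))" if "t \<ge> 0" for t
    using sol(1)[OF that] by (intro graph_laplacian_weighted_laplacian assms) (simp add: prob_interior_def)
  have D: "D t \<ge> 0" if "t \<ge> 0" for t
    using graph_laplacian.psd[OF lap[OF that]] by (simp add: D_def)
  have F': "(F has_real_derivative - D t) (at t within {0..})" if "t \<ge> 0" for t
    using free_energy_has_derivative[OF assms(3) _ sol(2)[OF that], of V \<beta>] sol(1)[OF that]
      graph_laplacian.inner_one[OF lap[OF that]]
    unfolding F_def D_def fp_rhs_eq by (simp add: prob_interior_def)
  have F'_at: "(F has_real_derivative - D t) (at t)" if "t > 0" for t
    using F'[of t] that at_within_interior[of t "{0..}"] by simp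
  \<comment> \<open>At 0 only a one-sided derivative is available, so monotonicity is derived from
    continuity on the closed interval and derivatives in its interior.\<close>
  have decr: "F t \<le> F 0" if "t \<ge> 0" for t
  proof (cases "t = 0")
    case False
    have "continuous_on {0..} F"
      using F' by (auto simp: continuous_on_eq_continuous_within intro: DERIV_continuous)
    then have "continuous_on {0..t} F"
      by (rule continuous_on_subset) auto
    moreover have "\<exists>y. (F has_real_derivative y) (at s) \<and> y \<le> 0" if "0 < s" "s < t" for s
      using F'_at[of s] D[of s] that by auto
    ultimately show ?thesis
      using DERIV_nonpos_imp_decreasing_open[of 0 t F] that by blast
  qed simp
  have eq: "\<rho>inf \<in> fp_equilibria E \<omega> W V \<beta>"
    using assms(8) by (simp add: isolated_in_def)
  have inf_pos: "\<rho>inf $ i > 0" for i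
    using eq by (simp add: fp_equilibria_def prob_interior_def)
  have "\<exists>T>0. \<forall>t>T. F t - free_energy W V \<beta> \<rho>inf
      \<le> exp (- 2 * (lam - \<epsilon>) * (t - T)) * (F 0 - free_energy W V \<beta> \<rho>inf)"
    if \<epsilon>: "0 < \<epsilon>" "\<epsilon> < lam" for \<epsilon>
  proof -
    obtain k where k: "k > 0"
      "\<And>\<rho>. \<rho> \<in> prob_interior \<Longrightarrow> \<forall>i. \<bar>\<rho> $ i - \<rho>inf $ i\<bar> \<le> k * \<rho>inf $ i \<Longrightarrow>
        2 * (lam - \<epsilon>) * (free_energy W V \<beta> \<rho> - free_energy W V \<beta> \<rho>inf)
        \<le> potential W V \<beta> \<rho> \<bullet> (weighted_laplacian E \<omega> \<rho> *v potential W V \<beta> \<rho>)"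
      using free_energy_dissipation_near[OF assms(1-4) eq assms(9,10) \<epsilon>] by blast
    have "\<forall>\<^sub>F t in at_top. \<forall>i. \<bar>\<rho> t $ i - \<rho>inf $ i\<bar> \<le> k * \<rho>inf $ i"
    proof (rule eventually_all_finite)
      fix i
      have "((\<lambda>t. \<rho> t $ i) \<longlongrightarrow> \<rho>inf $ i) at_top"
        using assms(7) by (rule tendsto_vec_nth)
      then have "\<forall>\<^sub>F t in at_top. dist (\<rho> t $ i) (\<rho>inf $ i) < k * \<rho>inf $ i"
        using k(1) inf_pos[of i] by (intro tendstoD) simp_all
      then show "\<forall>\<^sub>F t in at_top. \<bar>\<rho> t $ i - \<rho>inf $ i\<bar> \<le> k * \<rho>inf $ i"
        by eventually_elim (simp add: dist_real_def)
    qed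
    then obtain N where N: "\<And>t i. t \<ge> N \<Longrightarrow> \<bar>\<rho> t $ i - \<rho>inf $ i\<bar> \<le> k * \<rho>inf $ i"
      by (auto simp: eventually_at_top_linorder)
    \<comment> \<open>The maximum with 1 keeps \<open>T\<close> positive, where the derivative is
      two-sided.\<close>
    define T where "T = max N 1"
    have "F t - free_energy W V \<beta> \<rho>inf
        \<le> exp (- 2 * (lam - \<epsilon>) * (t - T)) * (F 0 - free_energy W V \<beta> \<rho>inf)" if "t > T" for t
    proof -
      have "F t - free_energy W V \<beta> \<rho>inf
          \<le> exp (- (2 * (lam - \<epsilon>)) * (t - T)) * (F T - free_energy W V \<beta> \<rho>inf)"
      proof (rule Gronwall_decay)
        fix s assume "T \<le> s"
        then have s: "s > 0" "s \<ge> N" by (auto simp: T_def)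
        show "((\<lambda>t. F t - free_energy W V \<beta> \<rho>inf) has_real_derivative - D s) (at s)"
          using F'_at[OF s(1)] by (auto intro!: derivative_eq_intros)
        show "- D s \<le> - (2 * (lam - \<epsilon>)) * (F s - free_energy W V \<beta> \<rho>inf)"
          unfolding D_def F_def mult_minus_left neg_le_iff_le
          using sol(1)[of s] N[OF s(2)] s(1) by (intro k(2)) auto
      qed (use that in simp)
      \<comment> \<open>Monotone energy replaces the gap at \<open>T\<close> by the initial
        one.\<close>
      also have "\<dots> \<le> exp (- (2 * (lam - \<epsilon>)) * (t - T)) * (F 0 - free_energy W V \<beta> \<rho>inf)"
        using decr[of T] by (intro mult_left_mono) (auto simp: T_def)
      finally show ?thesis by simp
    qed
    moreover have "T > 0" by (simp add: T_def)
    ultimately show ?thesis by blast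
  qed
  moreover have "F 0 = free_energy W V \<beta> \<rho>0"
    using assms(6) by (simp add: F_def fp_solution_def)
  ultimately show ?thesis
    \<comment> \<open>Every positive \<open>\<epsilon>\<close> below \<open>lam\<close> works, so
      \<open>lam\<close> itself is the threshold.\<close>
    unfolding F_def by (intro exI[of _ lam]) (use assms(10) in auto)
qed

end
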